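(* Let $m\in\mathcal X^m$ and $\Gamma:=\Phi(m,\mathcal X^s)-H(m)$, and assume all stable states lie in one cycle, namely in $\mathcal C^{\mathcal X^s}_m(\Gamma+H(m)-H(\mathcal X^s))$. Let $\mathcal W(m,\mathcal X^s)$ be a gate for the transition $m\to\mathcal X^s$, and let $K$ be the associated set of saddles defined in the context. Then every saddle of the first type, i.e. every $$\sigma\in\partial\mathcal C^m_{\mathcal X^s}(\Gamma)\cap\big(\mathcal S(m,\mathcal X^s)\setminus(\mathcal W(m,\mathcal X^s)\cup K)\big),$$ is unessential, and therefore $\sigma\notin\mathcal G(m,\mathcal X^s)$.
   Context: $\mathcal X$ is a finite state space, $H:\mathcal X\to\mathbb R$ a Hamiltonian, and the dynamics is an irreducible Metropolis chain: for $\eta\ne\eta'$, $P(\eta,\eta')=q(\eta,\eta')e^{-\beta[H(\eta')-H(\eta)]_+}$ with $q$ symmetric and irreducible. A path $\omega:\eta\to\eta'$ is a finite sequence $(\omega_1,\dots,\omega_k)$ with $\omega_1=\eta$, $\omega_k=\eta'$, $P(\omega_i,\omega_{i+1})>0$; $\omega_1\circ\omega_2$ denotes concatenation of paths. Communication height: $\Phi(\eta,\eta')=\min_{\omega:\eta\to\eta'}\max_{\zeta\in\omega}H(\zeta)$, and for sets $\Phi(\mathcal A,\mathcal B)=\min_{\eta\in\mathcal A,\eta'\in\mathcal B}\Phi(\eta,\eta')$. $\mathcal X^s$ is the set of global minima of $H$ (stable states), with common energy $H(\mathcal X^s)$. Stability level: $V_\zeta=\Phi(\zeta,\mathcal I_\zeta)-H(\zeta)$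 with $\mathcal I_\zeta=\{\eta:H(\eta)<H(\zeta)\}$ ($V_\zeta=\infty$ if $\mathcal I_\zeta=\emptyset$). Metastable states: $\mathcal X^m=\{\eta:V_\eta=\max_{\zeta\in\mathcal X\setminus\mathcal X^s}V_\zeta\}$. Optimal paths from $m$ to $\mathcal X^s$, $(m\to\mathcal X^s)_{opt}$: paths $\omega$ from $m$ to $\mathcal X^s$ with $\max_\omega H=\Phi(m,\mathcal X^s)$. Saddles: $\mathcal S(m,\mathcal X^s)=\{\zeta:\exists\,\omega\in(m\to\mathcal X^s)_{opt},\ \omega\ni\zeta,\ \max_\omega H=H(\zeta)\}$. $\arg\max_\omega H$ is the set of configurations of $\omega$ with maximal energy along $\omega$. A saddle $\xi$ is unessential if for every optimal $\omega$ with $\xi\in\omega$ one has $\arg\max_\omega H\setminus\{\xi\}\neq\emptyset$ and there is an optimal $\omega'$ with $\arg\max_{\omega'}H\subseteq\arg\max_\omega H\setminus\{\xi\}$. A gate is a set $\mathcal W\subseteq\mathcal S(m,\mathcal X^s)$ met by every optimal path; a minimal gate is a gate such that for every $\mathcal W'\subsetneq\mathcal W$ some optimal path avoids $\mathcal W'$; $\mathcal G(m,\mathcal X^s)$ is the union of all minimal gates. Initial cycles: $\mathcal C^m_{\mathcal X^s}(\Gamma)=\{m\}\cup\{\eta:\Phi(m,\eta)-H(m)<\Gamma\}$ and $\mathcal C^{\mathcal X^s}_m(\Gamma+H(m)-H(\mathcal X^s))=\mathcal X^s\cup\{\eta:\Phi(\mathcal X^s,\eta)<\Gamma+H(m)\}$.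 All stable states lie in one cycle means that they communicate with each other at height strictly below $\Gamma+H(m)$. For $\mathcal A\subset\mathcal X$, $\partial\mathcal A=\{\eta\notin\mathcal A:\exists\,\zeta\in\mathcal A,\ P(\zeta,\eta)>0\}$. $K$ is the set of $\bar\eta\in\mathcal S(m,\mathcal X^s)\setminus\mathcal W(m,\mathcal X^s)$ for which there exist $\eta\in\mathcal W(m,\mathcal X^s)$ and $\omega=\omega_1\circ\omega_2$ with $\max_{\sigma\in\omega}H(\sigma)\le\Gamma+H(m)$, where $\omega_1:\eta\to\bar\eta$ satisfies $\omega_1\cap\mathcal W(m,\mathcal X^s)=\{\eta\}$ and $\omega_1\cap\mathcal C^m_{\mathcal X^s}(\Gamma)=\emptyset$, and $\omega_2:\bar\eta\to m$ satisfies $\omega_2\cap\mathcal W(m,\mathcal X^s)=\emptyset$.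
   Formalization: The formal statement additionally assumes that Γ > 0 or that m does not belong to the gate W(m,X^s); without this the claim fails, e.g. on the line m – σ – s with H = 1, 1, 0 and W = {m}. *)

theory Defs
  imports Complex_Main "HOL-Library.Extended_Real"
begin

text \<open>
  The state space is the finite type \<^typ>\<open>'a\<close>. The row sums determine the holding
  probabilities \<^term>\<open>P x x\<close>.
\<close>

locale metropolis_chain =
  fixes H :: "'a::finite \<Rightarrow> real" and q :: "'a \<Rightarrow> 'a \<Rightarrow> real" and \<beta> :: real
    and P :: "'a \<Rightarrow> 'a \<Rightarrow> real"
  assumes P_nonneg: "0 \<le> P x y"
    and P_row_sum: "(\<Sum>y\<in>UNIV. P x y) = 1"
    and P_metropolis: "x \<noteq> y \<Longrightarrow> P x y = q x y * exp (- \<beta> * max 0 (H y - H x))"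
    and q_sym: "q x y = q y x"
    and q_irreducible: "(\<lambda>u v. q u v > 0)\<^sup>*\<^sup>* x y"

definition chain_path :: "('a \<Rightarrow> 'a \<Rightarrow> real) \<Rightarrow> 'a \<Rightarrow> 'a \<Rightarrow> 'a list \<Rightarrow> bool" where
  "chain_path P x y w \<longleftrightarrow>
     w \<noteq> [] \<and> hd w = x \<and> last w = y \<and> (\<forall>i. Suc i < length w \<longrightarrow> P (w ! i) (w ! Suc i) > 0)"

definition path_height :: "('a \<Rightarrow> real) \<Rightarrow> 'a list \<Rightarrow> real" where
  "path_height H w = Max (H ` set w)"

definition path_argmax :: "('a \<Rightarrow> real) \<Rightarrow> 'a list \<Rightarrow> 'a set" where
  "path_argmax H w = {x \<in> set w. H x = path_height H w}"

text \<open>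
  For an irreducible chain on a finite type both minima below are over nonempty finite sets
  of reals (for the second one, when the two sets of states are nonempty).
\<close>

definition comm_height :: "('a \<Rightarrow> real) \<Rightarrow> ('a \<Rightarrow> 'a \<Rightarrow> real) \<Rightarrow> 'a \<Rightarrow> 'a \<Rightarrow> real" where
  "comm_height H P x y = Min {path_height H w | w. chain_path P x y w}"

definition set_comm_height ::
  "('a \<Rightarrow> real) \<Rightarrow> ('a \<Rightarrow> 'a \<Rightarrow> real) \<Rightarrow> 'a set \<Rightarrow> 'a set \<Rightarrow> real" where
  "set_comm_height H P A B = Min {comm_height H P x y | x y. x \<in> A \<and> y \<in> B}"

definition stable_states :: "('a \<Rightarrow> real) \<Rightarrow> 'a set" where
  "stable_states H = {x. \<forall>y. H x \<le> H y}"

definition lower_states :: "('a \<Rightarrow> real) \<Rightarrow> 'a \<Rightarrow> 'a set" where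
  "lower_states H z = {x. H x < H z}"

definition stability_level :: "('a \<Rightarrow> real) \<Rightarrow> ('a \<Rightarrow> 'a \<Rightarrow> real) \<Rightarrow> 'a \<Rightarrow> ereal" where
  "stability_level H P z =
     (if lower_states H z = {} then \<infinity>
      else ereal (set_comm_height H P {z} (lower_states H z) - H z))"

text \<open>
  If every state is stable, the maximum defining the metastable states is over the empty set;
  there are then no metastable states.
\<close>

definition metastable_states :: "('a \<Rightarrow> real) \<Rightarrow> ('a \<Rightarrow> 'a \<Rightarrow> real) \<Rightarrow> 'a set" where
  "metastable_states H P =
     {x. UNIV - stable_states H \<noteq> {} \<and>
         stability_level H P x = Max (stability_level H P ` (UNIV - stable_states H))}"

definition optimal_paths ::
  "('a \<Rightarrow> real) \<Rightarrow> ('a \<Rightarrow> 'a \<Rightarrow> real) \<Rightarrow> 'a \<Rightarrow> 'a set \<Rightarrow> 'a list set" where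
  "optimal_paths H P m B =
     {w. (\<exists>s\<in>B. chain_path P m s w) \<and> path_height H w = set_comm_height H P {m} B}"

definition saddles ::
  "('a \<Rightarrow> real) \<Rightarrow> ('a \<Rightarrow> 'a \<Rightarrow> real) \<Rightarrow> 'a \<Rightarrow> 'a set \<Rightarrow> 'a set" where
  "saddles H P m B = {z. \<exists>w\<in>optimal_paths H P m B. z \<in> set w \<and> path_height H w = H z}"

definition unessential ::
  "('a \<Rightarrow> real) \<Rightarrow> ('a \<Rightarrow> 'a \<Rightarrow> real) \<Rightarrow> 'a \<Rightarrow> 'a set \<Rightarrow> 'a \<Rightarrow> bool" where
  "unessential H P m B \<xi> \<longleftrightarrow>
     \<xi> \<in> saddles H P m B \<and>
     (\<forall>w\<in>optimal_paths H P m B. \<xi> \<in> set w \<longrightarrow>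
        path_argmax H w - {\<xi>} \<noteq> {} \<and>
        (\<exists>w'\<in>optimal_paths H P m B. path_argmax H w' \<subseteq> path_argmax H w - {\<xi>}))"

definition gate ::
  "('a \<Rightarrow> real) \<Rightarrow> ('a \<Rightarrow> 'a \<Rightarrow> real) \<Rightarrow> 'a \<Rightarrow> 'a set \<Rightarrow> 'a set \<Rightarrow> bool" where
  "gate H P m B W \<longleftrightarrow>
     W \<subseteq> saddles H P m B \<and> (\<forall>w\<in>optimal_paths H P m B. set w \<inter> W \<noteq> {})"

definition minimal_gate ::
  "('a \<Rightarrow> real) \<Rightarrow> ('a \<Rightarrow> 'a \<Rightarrow> real) \<Rightarrow> 'a \<Rightarrow> 'a set \<Rightarrow> 'a set \<Rightarrow> bool" where
  "minimal_gate H P m B W \<longleftrightarrow>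
     gate H P m B W \<and> (\<forall>W'. W' \<subset> W \<longrightarrow> (\<exists>w\<in>optimal_paths H P m B. set w \<inter> W' = {}))"

definition minimal_gates_union ::
  "('a \<Rightarrow> real) \<Rightarrow> ('a \<Rightarrow> 'a \<Rightarrow> real) \<Rightarrow> 'a \<Rightarrow> 'a set \<Rightarrow> 'a set" where
  "minimal_gates_union H P m B = \<Union>{W. minimal_gate H P m B W}"

definition initial_cycle ::
  "('a \<Rightarrow> real) \<Rightarrow> ('a \<Rightarrow> 'a \<Rightarrow> real) \<Rightarrow> 'a \<Rightarrow> real \<Rightarrow> 'a set" where
  "initial_cycle H P m \<Gamma> = {m} \<union> {x. comm_height H P m x - H m < \<Gamma>}"

text \<open>
  The initial cycle of the stable states is the union of \<^term>\<open>stable_states H\<close> and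
  \<^term>\<open>{x. set_comm_height H P (stable_states H) {x} < \<Gamma> + H m}\<close>. It contains every stable
  state by construction; that the stable states lie in a single cycle is the following
  condition.
\<close>

definition stable_in_one_cycle ::
  "('a \<Rightarrow> real) \<Rightarrow> ('a \<Rightarrow> 'a \<Rightarrow> real) \<Rightarrow> 'a \<Rightarrow> real \<Rightarrow> bool" where
  "stable_in_one_cycle H P m \<Gamma> \<longleftrightarrow>
     (\<forall>s\<in>stable_states H. \<forall>s'\<in>stable_states H. comm_height H P s s' < \<Gamma> + H m)"

definition outer_boundary :: "('a \<Rightarrow> 'a \<Rightarrow> real) \<Rightarrow> 'a set \<Rightarrow> 'a set" where
  "outer_boundary P A = {x. x \<notin> A \<and> (\<exists>z\<in>A. P z x > 0)}"

text \<open>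
  The saddles \<open>y\<close> from which \<open>m\<close> can be reached without meeting \<open>W\<close>, and which can be reached
  from \<open>W\<close> outside the initial cycle of \<open>m\<close>. Since \<open>w1\<close> ends where \<open>w2\<close> starts, their
  concatenation as paths is \<^term>\<open>w1 @ tl w2\<close>.
\<close>

definition K_set ::
  "('a \<Rightarrow> real) \<Rightarrow> ('a \<Rightarrow> 'a \<Rightarrow> real) \<Rightarrow> 'a \<Rightarrow> 'a set \<Rightarrow> real \<Rightarrow> 'a set \<Rightarrow> 'a set" where
  "K_set H P m B \<Gamma> W =
     {y \<in> saddles H P m B - W.
        \<exists>x\<in>W. \<exists>w1 w2.
          path_height H (w1 @ tl w2) \<le> \<Gamma> + H m \<and>
          chain_path P x y w1 \<and> set w1 \<inter> W = {x} \<and> set w1 \<inter> initial_cycle H P m \<Gamma> = {} \<and>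
          chain_path P y m w2 \<and> set w2 \<inter> W = {}}"

end

theory Submission
  imports Defs
begin

text \<open>
  Write \<open>M = \<Gamma> + H m\<close> for the height of the optimal paths and \<open>C\<close> for the initial cycle of \<open>m\<close>.
  Every saddle lies at height \<open>M\<close>, while every state of \<open>C\<close> is joined to \<open>m\<close> by a path that stays
  strictly below \<open>M\<close>, except possibly at \<open>m\<close> itself. By the nondegeneracy hypothesis such
  connections miss the gate \<open>W\<close>, and used as the beginning of an optimal path they add nothing
  to its argmax apart from \<open>m\<close>, which lies on every optimal path anyway.

  Let an optimal path visit \<open>\<sigma>\<close>, and consider its part after the last such visit. This part meets
  \<open>W\<close>: otherwise \<open>m\<close> could walk through \<open>C\<close> to the boundary point \<open>\<sigma>\<close> and continue along it to
  a stable state, which would be an optimal path avoiding the gate. It also returns to \<open>C\<close>: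
  otherwise the piece from \<open>\<sigma>\<close> to its first state \<open>\<eta>\<close> in \<open>W\<close> can be reversed, because the
  transitions of a Metropolis chain are symmetric, and leads from \<open>\<eta>\<close> to \<open>\<sigma>\<close> outside \<open>C\<close>, meeting
  \<open>W\<close> only in \<open>\<eta>\<close>; since \<open>\<sigma>\<close> is connected through \<open>C\<close> to \<open>m\<close> off \<open>W\<close>, it would belong to the
  exceptional set \<open>K\<close>. This is \<open>path_after_boundary_saddle_returns\<close>.

  Hence the path can be shortcut: go from \<open>m\<close> inside \<open>C\<close> to the state of \<open>C\<close> found after the last
  visit to \<open>\<sigma>\<close>, then follow the original path. The new path is optimal, and its argmax is contained
  in the old one without \<open>\<sigma>\<close> (\<open>optimal_path_bypass\<close>). So \<open>\<sigma>\<close> is unessential, and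
  \<open>unessential_not_in_minimal_gate\<close> excludes such saddles from every minimal gate.
\<close>

section \<open>Paths\<close>

lemma chain_path_successively:
  "chain_path P x y w \<longleftrightarrow>
     w \<noteq> [] \<and> hd w = x \<and> last w = y \<and> successively (\<lambda>u v. P u v > 0) w"
  unfolding chain_path_def successively_conv_nth by blast

lemma chain_path_append:
  assumes "chain_path P x y (u @ [z])" and "chain_path P z y' (z # v)"
  shows "chain_path P x y' (u @ z # v)"
  using assms
  by (auto simp: chain_path_successively successively_append_iff hd_append split: if_splits)

lemma chain_path_prefix:
  assumes "chain_path P x y (u @ z # v)"
  shows "chain_path P x z (u @ [z])"
  using assms
  by (auto simp: chain_path_successively successively_append_iff hd_append split: if_splits)

lemma chain_path_suffix:
  assumes "chain_path P x y (u @ z # v)"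
  shows "chain_path P z y (z # v)"
  using assms
  by (auto simp: chain_path_successively successively_append_iff)

lemma chain_path_snoc:
  assumes "chain_path P x y w" and "P y z > 0"
  shows "chain_path P x z (w @ [z])"
  using assms
  by (auto simp: chain_path_successively successively_append_iff)

lemma chain_path_ends:
  assumes "chain_path P x y w"
  shows "x \<in> set w" and "y \<in> set w"
  using assms by (auto simp: chain_path_successively)

lemma path_height_le_iff:
  assumes "w \<noteq> []"
  shows "path_height H w \<le> h \<longleftrightarrow> (\<forall>x\<in>set w. H x \<le> h)"
  using assms by (simp add: path_height_def)

lemma le_path_height:
  assumes "x \<in> set w"
  shows "H x \<le> path_height H w"
  using assms by (simp add: path_height_def)

context metropolis_chain
begin

lemma P_pos_iff: "x \<noteq> y \<Longrightarrow> P x y > 0 \<longleftrightarrow> q x y > 0"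
  by (simp add: P_metropolis zero_less_mult_iff)

lemma P_pos_sym: "P x y > 0 \<longleftrightarrow> P y x > 0"
  by (cases "x = y") (simp_all add: P_pos_iff q_sym)

lemma chain_path_rev:
  assumes "chain_path P x y w"
  shows "chain_path P y x (rev w)"
proof -
  have "successively (\<lambda>u v. P v u > 0) w"
    using assms by (simp add: chain_path_successively P_pos_sym)
  then show ?thesis
    using assms by (simp add: chain_path_successively hd_rev last_rev)
qed

text \<open>
  A loop of \<^term>\<open>q\<close> at a state need not be a transition of the chain, because the holding
  probabilities are not determined by \<^term>\<open>q\<close>; such loops are left out of the path.
\<close>

lemma chain_path_exists: "\<exists>w. chain_path P x y w"
  using q_irreducible[of x y]
proof (induction rule: rtranclp_induct)
  case base
  have "chain_path P x x [x]" by (simp add: chain_path_def)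
  then show ?case ..
next
  case (step y z)
  then show ?case by (metis P_pos_iff chain_path_snoc)
qed

section \<open>Communication heights\<close>

lemma finite_path_heights: "finite {path_height H w | w. chain_path P x y w}"
proof (rule finite_subset)
  show "{path_height H w | w. chain_path P x y w} \<subseteq> range H"
    unfolding path_height_def chain_path_def
    using Max_in[of "H ` set w" for w] by fastforce
qed simp

lemma comm_height_attained: "\<exists>w. chain_path P x y w \<and> path_height H w = comm_height H P x y"
proof -
  have "comm_height H P x y \<in> {path_height H w | w. chain_path P x y w}"
    unfolding comm_height_def
    using finite_path_heights chain_path_exists by (intro Min_in) auto
  then show ?thesis by auto
qed

lemma set_comm_height_le_path_height:
  assumes "x \<in> A" and "y \<in> B" and "chain_path P x y w"
  shows "set_comm_height H P A B \<le> path_height H w"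
proof -
  have "set_comm_height H P A B \<le> comm_height H P x y"
    unfolding set_comm_height_def
  proof (rule Min_le)
    show "finite {comm_height H P x y | x y. x \<in> A \<and> y \<in> B}"
      by (rule finite_subset[of _ "range (case_prod (comm_height H P))"]) auto
  qed (use assms in auto)
  also have "\<dots> \<le> path_height H w"
    unfolding comm_height_def using finite_path_heights assms(3) by (intro Min_le) auto
  finally show ?thesis .
qed

lemma optimal_pathI:
  assumes "s \<in> B" and "chain_path P m s w" and "\<forall>x\<in>set w. H x \<le> set_comm_height H P {m} B"
  shows "w \<in> optimal_paths H P m B"
proof -
  have "w \<noteq> []" using assms(2) by (simp add: chain_path_def)
  then have "path_height H w \<le> set_comm_height H P {m} B"
    using assms(3) by (simp add: path_height_le_iff)
  then show ?thesis
    using assms set_comm_height_le_path_height[of m "{m}" s B w]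
    unfolding optimal_paths_def by auto
qed

text \<open>
  The exception at \<open>m\<close> is needed: for \<open>\<Gamma> = 0\<close> the initial cycle consists of \<open>m\<close> alone,
  which then lies at the height \<open>\<Gamma> + H m\<close>.
\<close>

lemma initial_cycle_path:
  assumes "z \<in> initial_cycle H P m \<Gamma>"
  obtains u where "chain_path P m z (u @ [z])"
    and "\<forall>x\<in>set (u @ [z]). x = m \<or> H x < \<Gamma> + H m"
proof (cases "z = m")
  case True
  then show ?thesis by (intro that[of "[]"]) (simp_all add: chain_path_def)
next
  case False
  then have below: "comm_height H P m z < \<Gamma> + H m"
    using assms by (auto simp: initial_cycle_def)
  obtain w where w: "chain_path P m z w" "path_height H w = comm_height H P m z"
    using comm_height_attained by blast
  have "w = butlast w @ [z]"
    using w(1) by (metis append_butlast_last_id chain_path_def)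
  moreover have "\<forall>x\<in>set w. H x < \<Gamma> + H m"
    using le_path_height[of _ w H] w(2) below by fastforce
  ultimately show ?thesis using w(1) that by metis
qed

end

section \<open>Gates and unessential saddles\<close>

lemma saddle_height: "z \<in> saddles H P m B \<Longrightarrow> H z = set_comm_height H P {m} B"
  by (auto simp: saddles_def optimal_paths_def)

lemma optimal_path_argmax:
  assumes "w \<in> optimal_paths H P m B"
  shows "path_argmax H w = {x \<in> set w. H x = set_comm_height H P {m} B}"
  using assms by (simp add: path_argmax_def optimal_paths_def)

text \<open>
  The premise on \<open>x\<close> is what \<open>initial_cycle_path\<close> gives for the states of its path; a gate
  contains only states at the height \<open>\<Gamma> + H m\<close>.
\<close>

lemma below_saddle_height_off_gate:
  assumes \<Gamma>: "\<Gamma> = set_comm_height H P {m} B - H m"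
    and "gate H P m B W" and "0 < \<Gamma> \<or> m \<notin> W"
    and "x = m \<or> H x < \<Gamma> + H m"
  shows "x \<notin> W"
proof
  assume "x \<in> W"
  then have "H x = \<Gamma> + H m"
    using assms(2) saddle_height[of x H P m B] \<Gamma> by (auto simp: gate_def)
  then show False using assms(3,4) \<open>x \<in> W\<close> by auto
qed

text \<open>
  By minimality some optimal path meets the gate in \<open>\<xi>\<close> only. An optimal path whose
  argmax is contained in that of this one without \<open>\<xi>\<close> would miss the gate, since gates consist
  of saddles and can only be met in the argmax.
\<close>

lemma unessential_not_in_minimal_gate:
  assumes "unessential H P m B \<xi>" and "minimal_gate H P m B G"
  shows "\<xi> \<notin> G"
proof
  assume "\<xi> \<in> G"
  have G: "gate H P m B G" using assms(2) by (simp add: minimal_gate_def)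
  have "G - {\<xi>} \<subset> G" using \<open>\<xi> \<in> G\<close> by blast
  then obtain w where w: "w \<in> optimal_paths H P m B" "set w \<inter> (G - {\<xi>}) = {}"
    using assms(2) unfolding minimal_gate_def by blast
  then have "\<xi> \<in> set w" using G unfolding gate_def by blast
  then obtain w' where w': "w' \<in> optimal_paths H P m B" "path_argmax H w' \<subseteq> path_argmax H w - {\<xi>}"
    using assms(1) w(1) unfolding unessential_def by blast
  obtain x where x: "x \<in> set w'" "x \<in> G" using G w'(1) unfolding gate_def by blast
  then have "x \<in> path_argmax H w'"
    using G saddle_height[of x] by (auto simp: gate_def optimal_path_argmax[OF w'(1)])
  then have "x \<in> set w \<inter> (G - {\<xi>})" using w'(2) x(2) by (auto simp: path_argmax_def)
  then show False using w(2) by blast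
qed

section \<open>Boundary saddles of the initial cycle\<close>

context metropolis_chain
begin

text \<open>
  If the path stayed outside the initial cycle, then either it would avoid \<open>W\<close> and, preceded by a
  path from \<open>m\<close> to \<open>\<sigma>\<close> through the cycle, contradict the gate property, or its reversed piece
  between \<open>\<sigma>\<close> and \<open>W\<close> would witness that \<open>\<sigma>\<close> lies in \<^const>\<open>K_set\<close>.
\<close>

lemma path_after_boundary_saddle_returns:
  fixes B :: "'a set" and m :: 'a and \<Gamma> :: real
  defines "C \<equiv> initial_cycle H P m \<Gamma>"
  assumes \<Gamma>: "\<Gamma> = set_comm_height H P {m} B - H m"
    and W: "gate H P m B W" "0 < \<Gamma> \<or> m \<notin> W"
    and \<sigma>: "\<sigma> \<in> outer_boundary P C" "\<sigma> \<in> saddles H P m B" "\<sigma> \<notin> W" "\<sigma> \<notin> K_set H P m B \<Gamma> W"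
    and path: "s \<in> B" "chain_path P \<sigma> s (\<sigma> # v)" "\<forall>x\<in>set v. H x \<le> \<Gamma> + H m"
    and m_le: "H m \<le> \<Gamma> + H m"
  shows "set v \<inter> C \<noteq> {}"
proof
  assume avoids_C: "set v \<inter> C = {}"
  have \<sigma>_height: "H \<sigma> = \<Gamma> + H m" using saddle_height[OF \<sigma>(2)] \<Gamma> by simp
  obtain z where "z \<in> C" "P z \<sigma> > 0" and \<sigma>_out: "\<sigma> \<notin> C"
    using \<sigma>(1) by (auto simp: outer_boundary_def)
  then obtain u where u: "chain_path P m z (u @ [z])"
      "\<forall>x\<in>set (u @ [z]). x = m \<or> H x < \<Gamma> + H m"
    using initial_cycle_path unfolding C_def by blast
  define p where "p = u @ [z]"
  have p_path: "chain_path P m \<sigma> (p @ [\<sigma>])"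
    using chain_path_snoc[OF u(1) \<open>P z \<sigma> > 0\<close>] by (simp add: p_def)
  have p_off: "set (p @ [\<sigma>]) \<inter> W = {}"
    using u(2) \<sigma>(3) below_saddle_height_off_gate[OF \<Gamma> W] by (auto simp: p_def)
  have p_le: "\<forall>x\<in>set (p @ [\<sigma>]). H x \<le> \<Gamma> + H m"
    using u(2) \<sigma>_height m_le by (auto simp: p_def)
  show False
  proof (cases "set v \<inter> W = {}")
    case True
    have "p @ \<sigma> # v \<in> optimal_paths H P m B"
      using chain_path_append[OF p_path path(2)] path(1,3) p_le \<Gamma>
      by (intro optimal_pathI[of s]) auto
    moreover have "set (p @ \<sigma> # v) \<inter> W = {}" using True p_off by auto
    ultimately show False using W(1) unfolding gate_def by blast
  next
    case False
    then obtain a \<eta> b where v: "v = a @ \<eta> # b" and "\<eta> \<in> W" and a_off: "\<forall>x\<in>set a. x \<notin> W"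
      using split_list_first_prop[of v "\<lambda>x. x \<in> W"] by blast
    define w1 where "w1 = rev (\<sigma> # a @ [\<eta>])"
    define w2 where "w2 = rev (p @ [\<sigma>])"
    have "chain_path P \<eta> \<sigma> w1"
      unfolding w1_def
      using chain_path_rev[OF chain_path_prefix[of P \<sigma> s "\<sigma> # a" \<eta> b]] path(2) v by simp
    moreover have "set w1 \<inter> W = {\<eta>}"
      using a_off \<open>\<eta> \<in> W\<close> \<sigma>(3) by (auto simp: w1_def)
    moreover have "set w1 \<inter> C = {}"
      using avoids_C \<sigma>_out by (auto simp: w1_def v)
    moreover have "chain_path P \<sigma> m w2"
      unfolding w2_def using p_path by (rule chain_path_rev)
    moreover have "set w2 \<inter> W = {}"
      using p_off by (auto simp: w2_def)
    moreover have "path_height H (w1 @ tl w2) \<le> \<Gamma> + H m"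
      using path(3) p_le \<sigma>_height
      by (subst path_height_le_iff) (auto simp: w1_def w2_def v)
    ultimately have "\<sigma> \<in> K_set H P m B \<Gamma> W"
      using \<sigma>(2,3) \<open>\<eta> \<in> W\<close> unfolding K_set_def C_def by blast
    then show False using \<sigma>(4) by blast
  qed
qed

text \<open>
  Splitting at the last visit to \<open>\<sigma>\<close> guarantees that the retained end of the path is free of \<open>\<sigma>\<close>.
\<close>

lemma optimal_path_bypass:
  assumes \<Gamma>: "\<Gamma> = set_comm_height H P {m} B - H m"
    and W: "gate H P m B W" "0 < \<Gamma> \<or> m \<notin> W"
    and \<sigma>: "\<sigma> \<in> outer_boundary P (initial_cycle H P m \<Gamma>)" "\<sigma> \<in> saddles H P m B"
      "\<sigma> \<notin> W" "\<sigma> \<notin> K_set H P m B \<Gamma> W"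
    and w: "w \<in> optimal_paths H P m B" "\<sigma> \<in> set w"
  shows "\<exists>w'\<in>optimal_paths H P m B. path_argmax H w' \<subseteq> path_argmax H w - {\<sigma>}"
proof -
  obtain s where s: "s \<in> B" "chain_path P m s w" and "path_height H w = \<Gamma> + H m"
    using w(1) \<Gamma> by (auto simp: optimal_paths_def)
  then have w_le: "\<forall>x\<in>set w. H x \<le> \<Gamma> + H m" using le_path_height[of _ w H] by fastforce
  have "m \<in> set w" using chain_path_ends(1)[OF s(2)] .
  have "m \<noteq> \<sigma>" using \<sigma>(1) by (auto simp: outer_boundary_def initial_cycle_def)
  obtain u v where uv: "w = u @ \<sigma> # v" "\<sigma> \<notin> set v" using split_list_last[OF w(2)] by blast
  have "set v \<inter> initial_cycle H P m \<Gamma> \<noteq> {}"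
  proof (rule path_after_boundary_saddle_returns[OF \<Gamma> W \<sigma> s(1)])
    show "chain_path P \<sigma> s (\<sigma> # v)" using chain_path_suffix s(2) uv(1) by metis
    show "\<forall>x\<in>set v. H x \<le> \<Gamma> + H m" using w_le uv(1) by simp
    show "H m \<le> \<Gamma> + H m" using w_le \<open>m \<in> set w\<close> by blast
  qed
  then obtain z a b where z: "z \<in> initial_cycle H P m \<Gamma>" and v: "v = a @ z # b"
    by (metis disjoint_iff split_list)
  obtain c where c: "chain_path P m z (c @ [z])"
      "\<forall>x\<in>set (c @ [z]). x = m \<or> H x < \<Gamma> + H m"
    using initial_cycle_path[OF z] by blast
  define w' where "w' = c @ z # b"
  have "chain_path P z s (z # b)"
    using chain_path_suffix[of P m s "u @ \<sigma> # a" z b] s(2) by (simp add: uv(1) v)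
  then have "chain_path P m s w'"
    unfolding w'_def by (rule chain_path_append[OF c(1)])
  moreover have "\<forall>x\<in>set w'. H x \<le> \<Gamma> + H m"
    using c(2) w_le \<open>m \<in> set w\<close> by (auto simp: w'_def uv(1) v)
  ultimately have w': "w' \<in> optimal_paths H P m B"
    using s(1) \<Gamma> by (intro optimal_pathI[of s]) auto
  have "path_argmax H w' \<subseteq> path_argmax H w - {\<sigma>}"
  proof
    fix x assume "x \<in> path_argmax H w'"
    then have "x \<in> set w'" and x: "H x = \<Gamma> + H m"
      using \<Gamma> by (simp_all add: optimal_path_argmax[OF w'])
    then have "x = m \<or> x \<in> set b" using c(2) by (auto simp: w'_def)
    then have "x \<in> set w - {\<sigma>}"
      using \<open>m \<in> set w\<close> \<open>m \<noteq> \<sigma>\<close> uv by (auto simp: v)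
    then show "x \<in> path_argmax H w - {\<sigma>}"
      using x \<Gamma> by (simp add: optimal_path_argmax[OF w(1)])
  qed
  then show ?thesis using w' by (rule bexI)
qed

text \<open>
  The bypass also supplies the first requirement on an unessential saddle, because the
  argmax of the new path is nonempty.
\<close>

lemma boundary_saddle_unessential:
  assumes "\<Gamma> = set_comm_height H P {m} B - H m"
    and "gate H P m B W" and "0 < \<Gamma> \<or> m \<notin> W"
    and "\<sigma> \<in> outer_boundary P (initial_cycle H P m \<Gamma>)" and "\<sigma> \<in> saddles H P m B"
    and "\<sigma> \<notin> W" and "\<sigma> \<notin> K_set H P m B \<Gamma> W"
  shows "unessential H P m B \<sigma>"
proof -
  have argmax_nonempty: "path_argmax H w \<noteq> {}" if "w \<in> optimal_paths H P m B" for w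
  proof -
    have "set w \<inter> W \<noteq> {}" using assms(2) that by (simp add: gate_def)
    then obtain x where "x \<in> set w" "x \<in> W" by blast
    then have "x \<in> path_argmax H w"
      using assms(2) saddle_height[of x] by (auto simp: gate_def optimal_path_argmax[OF that])
    then show ?thesis by blast
  qed
  show ?thesis
    unfolding unessential_def
  proof (intro conjI ballI impI)
    fix w assume w: "w \<in> optimal_paths H P m B" "\<sigma> \<in> set w"
    obtain w' where w': "w' \<in> optimal_paths H P m B" "path_argmax H w' \<subseteq> path_argmax H w - {\<sigma>}"
      using optimal_path_bypass[OF assms w] by blast
    then show "\<exists>w'\<in>optimal_paths H P m B. path_argmax H w' \<subseteq> path_argmax H w - {\<sigma>}" by blast
    show "path_argmax H w - {\<sigma>} \<noteq> {}" using w' argmax_nonempty by blast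
  qed (fact assms(5))
qed

end

theorem proposition3p3:
  fixes H :: "'a::finite \<Rightarrow> real" and q P :: "'a \<Rightarrow> 'a \<Rightarrow> real" and \<beta> \<Gamma> :: real
    and m \<sigma> :: 'a and W :: "'a set"
  assumes "metropolis_chain H q \<beta> P"
    and "m \<in> metastable_states H P"
    and "\<Gamma> = set_comm_height H P {m} (stable_states H) - H m"
    and "stable_in_one_cycle H P m \<Gamma>"
    and "gate H P m (stable_states H) W"
    and nondegenerate: "0 < \<Gamma> \<or> m \<notin> W"
    and "\<sigma> \<in> outer_boundary P (initial_cycle H P m \<Gamma>) \<inter>
           (saddles H P m (stable_states H) - (W \<union> K_set H P m (stable_states H) \<Gamma> W))"
  shows "unessential H P m (stable_states H) \<sigma> \<and>
         \<sigma> \<notin> minimal_gates_union H P m (stable_states H)"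
proof -
  interpret metropolis_chain H q \<beta> P by fact
  have "unessential H P m (stable_states H) \<sigma>"
    using boundary_saddle_unessential[OF assms(3,5) nondegenerate] assms(7) by blast
  then show ?thesis
    by (auto simp: minimal_gates_union_def dest: unessential_not_in_minimal_gate)
qed

end
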